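(* Let $\mathcal{Q}$ be a small quantaloid. A $\mathcal{Q}$-category $\mathbb{A}$ is $\mathcal{M}$-cocomplete if and only if it is $\mathcal{M}$-tensored and $\mathcal{M}$-conically cocomplete.
   Context: A quantaloid $\mathcal{Q}$ is a category whose hom-sets are complete lattices and whose composition preserves arbitrary joins in each variable; here $\mathcal{Q}$ is small, with object set $\mathcal{Q}_0$. For $f\colon X\to Y$, $g\colon Y\to Z$, $h\colon X\to Z$ in $\mathcal{Q}$, the implications are defined by $g\circ f\leq h\iff g\leq h\swarrow f\iff f\leq g\searrow h$. In a quantaloid, $f\colon X\to Y$ is left adjoint to $g\colon Y\to X$ ($f\dashv g$, and $g$ is right adjoint) if $1_X\leq g\circ f$ and $f\circ g\leq 1_Y$. A $\mathcal{Q}$-category $\mathbb{A}$ is a set $\mathbb{A}_0$ with a type map $|\cdot|\colon\mathbb{A}_0\to\mathcal{Q}_0$ and arrows $\mathbb{A}(x,y)\in\mathcal{Q}(|x|,|y|)$ with $1_{|x|}\leq\mathbb{A}(x,x)$ and $\mathbb{A}(y,z)\circ\mathbb{A}(x,y)\leq\mathbb{A}(x,z)$. A $\mathcal{Q}$-functor $F\colon\mathbb{A}\to\mathbb{B}$ is a type-preserving map with $\mathbb{A}(x,y)\leq\mathbb{B}(Fx,Fy)$. A $\mathcal{Q}$-distributor $\varphi\colon\mathbb{A}\to\mathbb{B}$ is a family $\varphi(x,y)\in\mathcal{Q}(|x|,|y|)$ ($x\in\mathbb{A}_0,y\in\mathbb{B}_0$) with $\mathbb{B}(y',y)\circ\varphi(x,y')\leq\varphi(x,y)$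 and $\varphi(x',y)\circ\mathbb{A}(x,x')\leq\varphi(x,y)$. With pointwise order, composition $(\psi\circ\varphi)(x,z)=\bigvee_{y}\psi(y,z)\circ\varphi(x,y)$ and identities $\mathbb{A}$ (the hom-arrows), $\mathcal{Q}$-categories and $\mathcal{Q}$-distributors form a quantaloid $\mathcal{Q}\text{-}\mathbf{Dist}$; left/right adjoint $\mathcal{Q}$-distributors, implications and meets of distributors are taken in this quantaloid. A $\mathcal{Q}$-functor $F\colon\mathbb{A}\to\mathbb{B}$ has cograph $F^\natural\colon\mathbb{B}\to\mathbb{A}$, $F^\natural(y,x)=\mathbb{B}(y,Fx)$. $*_X$ is the $\mathcal{Q}$-category with one object of type $X$ and hom-arrow $1_X$. The presheaf category $\mathcal{P}\mathbb{A}$ has as objects of type $X$ the $\mathcal{Q}$-distributors $\mu\colon\mathbb{A}\to *_X$, with $\mathcal{P}\mathbb{A}(\mu,\mu')=\mu'\swarrow\mu$; write $\mathcal{P}X=\mathcal{P}( *_X)$ (its objects of type $Y$ are the arrows $X\to Y$ of $\mathcal{Q}$). The Yoneda embedding is $\mathsf{Y}_{\mathbb{A}}\colon\mathbb{A}\to\mathcal{P}\mathbb{A}$, $a\mapsto\mathbb{A}(-,a)$. For $a\in\mathbb{A}_0$, $\mathbb{A}(a,-)$ is regarded as a $\mathcal{Q}$-functor $\mathbb{A}\to\mathcal{P}|a|$, $y\mapsto\mathbb{A}(a,y)$; thus $(\mathbb{A}(a,-))^\natural\colon\mathcal{P}|a|\to\mathbb{A}$ is given by $(\mathbb{A}(a,-))^\natural(f,y)=\mathbb{A}(a,y)\swarrow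 f$. Definitions. $\mathbb{A}$ is $\mathcal{M}$-cocomplete if the cograph $(\mathsf{Y}_{\mathbb{A}})^\natural\colon\mathcal{P}\mathbb{A}\to\mathbb{A}$ is a left adjoint $\mathcal{Q}$-distributor. $\mathbb{A}$ is $\mathcal{M}$-tensored if for every $a\in\mathbb{A}_0$ the cograph $(\mathbb{A}(a,-))^\natural\colon\mathcal{P}|a|\to\mathbb{A}$ is a left adjoint $\mathcal{Q}$-distributor. $\mathbb{A}$ is $\mathcal{M}$-conically cocomplete if for every $X\in\mathcal{Q}_0$ and all families $\{x_i\}\subseteq\mathbb{A}_0$ and $\{f_i\colon *_{|x_i|}\to *_X\}$ (indexed by the same set, the $f_i$ being $\mathcal{Q}$-distributors), the $\mathcal{Q}$-distributor $\bigwedge_i\big((\mathbb{A}(x_i,-))^\natural(f_i,-)\big)\colon *_X\to\mathbb{A}$ is a left adjoint whenever each individual $(\mathbb{A}(x_i,-))^\natural(f_i,-)\colon *_X\to\mathbb{A}$ is a left adjoint. *)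

theory Defs
  imports "HOL-Algebra.Complete_Lattice"
begin

section \<open>Quantaloids\<close>

text \<open>
  Hom-sets are not required to be disjoint: composition carries its three objects, so
  \<open>qcomp Q X Y Z g f\<close> is the composite of \<open>f\<close> from \<open>X\<close> to \<open>Y\<close> with \<open>g\<close> from \<open>Y\<close> to \<open>Z\<close>.
  Smallness is automatic, since the objects form a set.
\<close>

record ('o, 'm) quantaloid_data =
  Ob :: "'o set"
  Hom :: "'o \<Rightarrow> 'o \<Rightarrow> 'm gorder"
  qcomp :: "'o \<Rightarrow> 'o \<Rightarrow> 'o \<Rightarrow> 'm \<Rightarrow> 'm \<Rightarrow> 'm"
  ide :: "'o \<Rightarrow> 'm"

locale quantaloid =
  fixes Q :: "('o, 'm) quantaloid_data"
  assumes Hom_complete_lattice: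
      "\<And>X Y. X \<in> Ob Q \<Longrightarrow> Y \<in> Ob Q \<Longrightarrow> complete_lattice (Hom Q X Y)"
    and ide_closed: "\<And>X. X \<in> Ob Q \<Longrightarrow> ide Q X \<in> carrier (Hom Q X X)"
    and comp_closed:
      "\<And>X Y Z f g. \<lbrakk>X \<in> Ob Q; Y \<in> Ob Q; Z \<in> Ob Q;
         f \<in> carrier (Hom Q X Y); g \<in> carrier (Hom Q Y Z)\<rbrakk>
         \<Longrightarrow> qcomp Q X Y Z g f \<in> carrier (Hom Q X Z)"
    and comp_assoc:
      "\<And>W X Y Z f g h. \<lbrakk>W \<in> Ob Q; X \<in> Ob Q; Y \<in> Ob Q; Z \<in> Ob Q;
         f \<in> carrier (Hom Q W X); g \<in> carrier (Hom Q X Y); h \<in> carrier (Hom Q Y Z)\<rbrakk>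
         \<Longrightarrow> qcomp Q W X Z (qcomp Q X Y Z h g) f = qcomp Q W Y Z h (qcomp Q W X Y g f)"
    and comp_ide_left:
      "\<And>X Y f. \<lbrakk>X \<in> Ob Q; Y \<in> Ob Q; f \<in> carrier (Hom Q X Y)\<rbrakk>
         \<Longrightarrow> qcomp Q X Y Y (ide Q Y) f = f"
    and comp_ide_right:
      "\<And>X Y f. \<lbrakk>X \<in> Ob Q; Y \<in> Ob Q; f \<in> carrier (Hom Q X Y)\<rbrakk>
         \<Longrightarrow> qcomp Q X X Y f (ide Q X) = f"
    and comp_Sup_right:
      "\<And>X Y Z F g. \<lbrakk>X \<in> Ob Q; Y \<in> Ob Q; Z \<in> Ob Q;
         F \<subseteq> carrier (Hom Q X Y); g \<in> carrier (Hom Q Y Z)\<rbrakk>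
         \<Longrightarrow> qcomp Q X Y Z g (\<Squnion>\<^bsub>Hom Q X Y\<^esub> F)
             = \<Squnion>\<^bsub>Hom Q X Z\<^esub> ((\<lambda>f. qcomp Q X Y Z g f) ` F)"
    and comp_Sup_left:
      "\<And>X Y Z f G. \<lbrakk>X \<in> Ob Q; Y \<in> Ob Q; Z \<in> Ob Q;
         f \<in> carrier (Hom Q X Y); G \<subseteq> carrier (Hom Q Y Z)\<rbrakk>
         \<Longrightarrow> qcomp Q X Y Z (\<Squnion>\<^bsub>Hom Q Y Z\<^esub> G) f
             = \<Squnion>\<^bsub>Hom Q X Z\<^esub> ((\<lambda>g. qcomp Q X Y Z g f) ` G)"

section \<open>Categories enriched in a quantaloid\<close>

record ('o, 'm, 'a) qcat =
  obj :: "'a set"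
  type_of :: "'a \<Rightarrow> 'o"
  arr :: "'a \<Rightarrow> 'a \<Rightarrow> 'm"

locale qcategory = quantaloid Q
  for Q :: "('o, 'm) quantaloid_data" +
  fixes A :: "('o, 'm, 'a) qcat"
  assumes type_of_closed: "\<And>x. x \<in> obj A \<Longrightarrow> type_of A x \<in> Ob Q"
    and arr_closed:
      "\<And>x y. \<lbrakk>x \<in> obj A; y \<in> obj A\<rbrakk> \<Longrightarrow> arr A x y \<in> carrier (Hom Q (type_of A x) (type_of A y))"
    and arr_refl:
      "\<And>x. x \<in> obj A \<Longrightarrow> ide Q (type_of A x) \<sqsubseteq>\<^bsub>Hom Q (type_of A x) (type_of A x)\<^esub> arr A x x"
    and arr_trans:
      "\<And>x y z. \<lbrakk>x \<in> obj A; y \<in> obj A; z \<in> obj A\<rbrakk>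
         \<Longrightarrow> qcomp Q (type_of A x) (type_of A y) (type_of A z) (arr A y z) (arr A x y)
             \<sqsubseteq>\<^bsub>Hom Q (type_of A x) (type_of A z)\<^esub> arr A x z"

section \<open>The quantaloid of distributors\<close>

text \<open>
  The categories \<open>A\<close>, \<open>\<P>A\<close> and \<open>*\<^sub>X\<close> have objects of different HOL types, so the quantaloid of
  distributors is given by type-polymorphic operations rather than as one instance of
  \<open>quantaloid_data\<close>. Distributors are extensional functions, so that the pointwise order
  is antisymmetric.
\<close>

definition Dist ::
  "('o, 'm) quantaloid_data \<Rightarrow> ('o, 'm, 'a) qcat \<Rightarrow> ('o, 'm, 'b) qcat \<Rightarrow> ('a \<Rightarrow> 'b \<Rightarrow> 'm) gorder"
where
  "Dist Q A B =
    \<lparr>carrier =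
       {\<phi> \<in> (\<Pi>\<^sub>E x\<in>obj A. \<Pi>\<^sub>E y\<in>obj B. carrier (Hom Q (type_of A x) (type_of B y))).
         (\<forall>x\<in>obj A. \<forall>y'\<in>obj B. \<forall>y\<in>obj B.
            qcomp Q (type_of A x) (type_of B y') (type_of B y) (arr B y' y) (\<phi> x y')
              \<sqsubseteq>\<^bsub>Hom Q (type_of A x) (type_of B y)\<^esub> \<phi> x y) \<and>
         (\<forall>x\<in>obj A. \<forall>x'\<in>obj A. \<forall>y\<in>obj B.
            qcomp Q (type_of A x) (type_of A x') (type_of B y) (\<phi> x' y) (arr A x x')
              \<sqsubseteq>\<^bsub>Hom Q (type_of A x) (type_of B y)\<^esub> \<phi> x y)},
     eq = (=),
     le = (\<lambda>\<phi> \<psi>. \<forall>x\<in>obj A. \<forall>y\<in>obj B. \<phi> x y \<sqsubseteq>\<^bsub>Hom Q (type_of A x) (type_of B y)\<^esub> \<psi> x y)\<rparr>"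

definition dist_comp ::
  "('o, 'm) quantaloid_data \<Rightarrow> ('o, 'm, 'a) qcat \<Rightarrow> ('o, 'm, 'b) qcat \<Rightarrow> ('o, 'm, 'c) qcat
    \<Rightarrow> ('b \<Rightarrow> 'c \<Rightarrow> 'm) \<Rightarrow> ('a \<Rightarrow> 'b \<Rightarrow> 'm) \<Rightarrow> ('a \<Rightarrow> 'c \<Rightarrow> 'm)"
where
  "dist_comp Q A B C \<psi> \<phi> =
    (\<lambda>x\<in>obj A. \<lambda>z\<in>obj C.
      \<Squnion>\<^bsub>Hom Q (type_of A x) (type_of C z)\<^esub>
        ((\<lambda>y. qcomp Q (type_of A x) (type_of B y) (type_of C z) (\<psi> y z) (\<phi> x y)) ` obj B))"

definition dist_id :: "('o, 'm, 'a) qcat \<Rightarrow> ('a \<Rightarrow> 'a \<Rightarrow> 'm)" where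
  "dist_id A = (\<lambda>x\<in>obj A. \<lambda>y\<in>obj A. arr A x y)"

definition left_adjoint_dist ::
  "('o, 'm) quantaloid_data \<Rightarrow> ('o, 'm, 'a) qcat \<Rightarrow> ('o, 'm, 'b) qcat \<Rightarrow> ('a \<Rightarrow> 'b \<Rightarrow> 'm) \<Rightarrow> bool"
where
  "left_adjoint_dist Q A B \<phi> \<longleftrightarrow>
    \<phi> \<in> carrier (Dist Q A B) \<and>
    (\<exists>\<psi> \<in> carrier (Dist Q B A).
       dist_id A \<sqsubseteq>\<^bsub>Dist Q A A\<^esub> dist_comp Q A B A \<psi> \<phi> \<and>
       dist_comp Q B A B \<phi> \<psi> \<sqsubseteq>\<^bsub>Dist Q B B\<^esub> dist_id B)"

text \<open>
  The implication of \<open>h\<close> from \<open>A\<close> to \<open>C\<close> by \<open>f\<close> from \<open>A\<close> to \<open>B\<close>, a distributor from \<open>B\<close> to \<open>C\<close>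
  (usually written \<open>h \<swarrow> f\<close>).
\<close>

definition dist_impl ::
  "('o, 'm) quantaloid_data \<Rightarrow> ('o, 'm, 'a) qcat \<Rightarrow> ('o, 'm, 'b) qcat \<Rightarrow> ('o, 'm, 'c) qcat
    \<Rightarrow> ('a \<Rightarrow> 'c \<Rightarrow> 'm) \<Rightarrow> ('a \<Rightarrow> 'b \<Rightarrow> 'm) \<Rightarrow> ('b \<Rightarrow> 'c \<Rightarrow> 'm)"
where
  "dist_impl Q A B C h f =
    (THE k. k \<in> carrier (Dist Q B C) \<and>
      (\<forall>g \<in> carrier (Dist Q B C).
         dist_comp Q A B C g f \<sqsubseteq>\<^bsub>Dist Q A C\<^esub> h \<longleftrightarrow> g \<sqsubseteq>\<^bsub>Dist Q B C\<^esub> k))"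

definition cograph ::
  "('o, 'm, 'a) qcat \<Rightarrow> ('o, 'm, 'b) qcat \<Rightarrow> ('a \<Rightarrow> 'b) \<Rightarrow> ('b \<Rightarrow> 'a \<Rightarrow> 'm)"
where
  "cograph A B F = (\<lambda>y\<in>obj B. \<lambda>x\<in>obj A. arr B y (F x))"

section \<open>Presheaves\<close>

definition star :: "('o, 'm) quantaloid_data \<Rightarrow> 'o \<Rightarrow> ('o, 'm, unit) qcat" where
  "star Q X = \<lparr>obj = {()}, type_of = (\<lambda>_. X), arr = (\<lambda>_ _. ide Q X)\<rparr>"

text \<open>
  A presheaf is tagged with its type, which the underlying function does not always determine
  (hom-sets may overlap, and \<open>A\<close> may be empty).
\<close>

definition presheaf_cat ::
  "('o, 'm) quantaloid_data \<Rightarrow> ('o, 'm, 'a) qcat \<Rightarrow> ('o, 'm, 'o \<times> ('a \<Rightarrow> unit \<Rightarrow> 'm)) qcat"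
where
  "presheaf_cat Q A =
    \<lparr>obj = {(X, \<mu>). X \<in> Ob Q \<and> \<mu> \<in> carrier (Dist Q A (star Q X))},
     type_of = fst,
     arr = (\<lambda>(X, \<mu>) (X', \<mu>'). dist_impl Q A (star Q X) (star Q X') \<mu>' \<mu> () ())\<rparr>"

definition yoneda :: "('o, 'm, 'a) qcat \<Rightarrow> 'a \<Rightarrow> 'o \<times> ('a \<Rightarrow> unit \<Rightarrow> 'm)" where
  "yoneda A a = (type_of A a, \<lambda>x\<in>obj A. \<lambda>_. arr A x a)"

text \<open>
  The functor \<open>A(a,-)\<close> from \<open>A\<close> to \<open>\<P>|a| = presheaf_cat Q (star Q (type_of A a))\<close>; an arrow \<open>f\<close> of
  the quantaloid is identified with the distributor \<open>\<lambda>_ _. f\<close> between one-object categories.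
\<close>

definition hom_functor :: "('o, 'm, 'a) qcat \<Rightarrow> 'a \<Rightarrow> 'a \<Rightarrow> 'o \<times> (unit \<Rightarrow> unit \<Rightarrow> 'm)" where
  "hom_functor A a y = (type_of A y, \<lambda>_ _. arr A a y)"

definition hom_cograph ::
  "('o, 'm) quantaloid_data \<Rightarrow> ('o, 'm, 'a) qcat \<Rightarrow> 'a
    \<Rightarrow> 'o \<times> (unit \<Rightarrow> unit \<Rightarrow> 'm) \<Rightarrow> 'a \<Rightarrow> 'm"
where
  "hom_cograph Q A a = cograph A (presheaf_cat Q (star Q (type_of A a))) (hom_functor A a)"

section \<open>Cocompleteness via left adjoint distributors\<close>

definition M_cocomplete :: "('o, 'm) quantaloid_data \<Rightarrow> ('o, 'm, 'a) qcat \<Rightarrow> bool" where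
  "M_cocomplete Q A \<longleftrightarrow>
    left_adjoint_dist Q (presheaf_cat Q A) A (cograph A (presheaf_cat Q A) (yoneda A))"

definition M_tensored :: "('o, 'm) quantaloid_data \<Rightarrow> ('o, 'm, 'a) qcat \<Rightarrow> bool" where
  "M_tensored Q A \<longleftrightarrow>
    (\<forall>a\<in>obj A. left_adjoint_dist Q (presheaf_cat Q (star Q (type_of A a))) A (hom_cograph Q A a))"

text \<open>
  A definition cannot quantify over all index types. The index type below is large enough to
  index every set of pairs \<open>(x\<^sub>i, f\<^sub>i)\<close>, and by the lemma \<open>M_conically_cocompleteD\<close> below the
  property extends to families indexed by sets of any type. The empty family is included:
  its meet is the top distributor.
\<close>

definition M_conically_cocomplete ::
  "('o, 'm) quantaloid_data \<Rightarrow> ('o, 'm, 'a) qcat \<Rightarrow> bool"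
where
  "M_conically_cocomplete Q A \<longleftrightarrow>
    (\<forall>X \<in> Ob Q. \<forall>(I :: ('a \<times> (unit \<Rightarrow> unit \<Rightarrow> 'm)) set) x f.
       (\<forall>i\<in>I. x i \<in> obj A \<and> f i \<in> carrier (Dist Q (star Q (type_of A (x i))) (star Q X))) \<longrightarrow>
       (\<forall>i\<in>I. left_adjoint_dist Q (star Q X) A (\<lambda>_. hom_cograph Q A (x i) (X, f i))) \<longrightarrow>
       left_adjoint_dist Q (star Q X) A
         (\<Sqinter>\<^bsub>Dist Q (star Q X) A\<^esub> ((\<lambda>i _. hom_cograph Q A (x i) (X, f i)) ` I)))"

lemma M_conically_cocompleteD:
  fixes I :: "'i set" and x :: "'i \<Rightarrow> 'a" and f :: "'i \<Rightarrow> unit \<Rightarrow> unit \<Rightarrow> 'm"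
  assumes "M_conically_cocomplete Q A" and "X \<in> Ob Q"
    and "\<And>i. i \<in> I \<Longrightarrow> x i \<in> obj A"
    and "\<And>i. i \<in> I \<Longrightarrow> f i \<in> carrier (Dist Q (star Q (type_of A (x i))) (star Q X))"
    and "\<And>i. i \<in> I \<Longrightarrow> left_adjoint_dist Q (star Q X) A (\<lambda>_. hom_cograph Q A (x i) (X, f i))"
  shows "left_adjoint_dist Q (star Q X) A
           (\<Sqinter>\<^bsub>Dist Q (star Q X) A\<^esub> ((\<lambda>i _. hom_cograph Q A (x i) (X, f i)) ` I))"
proof -
  let ?J = "(\<lambda>i. (x i, f i)) ` I"
  have "left_adjoint_dist Q (star Q X) A
      (\<Sqinter>\<^bsub>Dist Q (star Q X) A\<^esub> ((\<lambda>p _. hom_cograph Q A (fst p) (X, snd p)) ` ?J))"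
    by (rule assms(1)[unfolded M_conically_cocomplete_def, rule_format, of X ?J fst snd])
      (use assms(2-) in force)+
  then show ?thesis
    by (simp add: image_image)
qed

end

theory Submission imports Defs begin

text \<open>
  A distributor into \<open>A\<close> is a left adjoint as soon as each of its rows, a distributor from a
  one-object category, is one (\<open>left_adjoint_dist_iff_rows\<close>). All three notions in the theorem
  therefore speak of distributors \<open>*\<^sub>X \<rightarrow> A\<close>: cocompleteness says that \<open>A \<swarrow> \<mu>\<close> is a left adjoint
  for every presheaf \<open>\<mu>\<close>, tensoredness that \<open>A(a,-) \<swarrow> f\<close> is one for every arrow \<open>f\<close> out of the
  type of \<open>a\<close>.

  These distributors are determined by the arrows below them. An arrow \<open>g\<close> is below
  \<open>(A \<swarrow> \<mu>)(y)\<close> iff \<open>g \<circ> \<mu>(x) \<le> A(x,y)\<close> for all \<open>x\<close>, and below \<open>A(a,y) \<swarrow> f\<close> iff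
  \<open>g \<circ> f \<le> A(a,y)\<close>. Two consequences carry the proof.

  \<^item> \<open>A \<swarrow> \<mu>\<close> is the meet of the \<open>A(x,-) \<swarrow> \<mu>(x)\<close>, so tensors and conical meets give
    cocompleteness (\<open>cograph_yoneda_eq_Inf\<close>).
  \<^item> Every meet of distributors \<open>A(x\<^sub>i,-) \<swarrow> f\<^sub>i\<close> is \<open>A \<swarrow> \<mu>\<close> for the presheaf
    \<open>\<mu> = \<Squnion>\<^sub>i f\<^sub>i \<circ> A(-,x\<^sub>i)\<close>, so cocompleteness makes all of them left adjoints
    (\<open>M_cocomplete_imp_left_adjoint_Inf\<close>). One-element families give tensors.
\<close>

section \<open>Order and composition in a quantaloid\<close>

context quantaloid
begin

lemma hom_refl:
  "\<lbrakk>X \<in> Ob Q; Y \<in> Ob Q; f \<in> carrier (Hom Q X Y)\<rbrakk> \<Longrightarrow> f \<sqsubseteq>\<^bsub>Hom Q X Y\<^esub> f"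
  by (meson Hom_complete_lattice complete_lattice_def partial_order_def
      lattice_def upper_semilattice_def weak_partial_order.le_refl)

lemma hom_trans [trans]:
  assumes "f \<sqsubseteq>\<^bsub>Hom Q X Y\<^esub> g" "g \<sqsubseteq>\<^bsub>Hom Q X Y\<^esub> h" "X \<in> Ob Q" "Y \<in> Ob Q"
    and "f \<in> carrier (Hom Q X Y)" "g \<in> carrier (Hom Q X Y)" "h \<in> carrier (Hom Q X Y)"
  shows "f \<sqsubseteq>\<^bsub>Hom Q X Y\<^esub> h"
proof -
  interpret L: complete_lattice "Hom Q X Y" by (rule Hom_complete_lattice) fact+
  show ?thesis using assms L.le_trans by blast
qed

lemma hom_antisym:
  assumes "f \<sqsubseteq>\<^bsub>Hom Q X Y\<^esub> g" "g \<sqsubseteq>\<^bsub>Hom Q X Y\<^esub> f" "X \<in> Ob Q" "Y \<in> Ob Q"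
    and "f \<in> carrier (Hom Q X Y)" "g \<in> carrier (Hom Q X Y)"
  shows "f = g"
proof -
  interpret L: complete_lattice "Hom Q X Y" by (rule Hom_complete_lattice) fact+
  show ?thesis using assms L.le_antisym by blast
qed

lemma Sup_closed:
  assumes "X \<in> Ob Q" "Y \<in> Ob Q" "F \<subseteq> carrier (Hom Q X Y)"
  shows "\<Squnion>\<^bsub>Hom Q X Y\<^esub> F \<in> carrier (Hom Q X Y)"
proof -
  interpret L: complete_lattice "Hom Q X Y" by (rule Hom_complete_lattice) fact+
  show ?thesis using assms by simp
qed

lemma Sup_upper:
  assumes "f \<in> F" "X \<in> Ob Q" "Y \<in> Ob Q" "F \<subseteq> carrier (Hom Q X Y)"
  shows "f \<sqsubseteq>\<^bsub>Hom Q X Y\<^esub> \<Squnion>\<^bsub>Hom Q X Y\<^esub> F"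
proof -
  interpret L: complete_lattice "Hom Q X Y" by (rule Hom_complete_lattice) fact+
  show ?thesis using assms L.sup_upper by simp
qed

lemma Sup_le_iff:
  assumes "X \<in> Ob Q" "Y \<in> Ob Q" "F \<subseteq> carrier (Hom Q X Y)" "h \<in> carrier (Hom Q X Y)"
  shows "\<Squnion>\<^bsub>Hom Q X Y\<^esub> F \<sqsubseteq>\<^bsub>Hom Q X Y\<^esub> h \<longleftrightarrow> (\<forall>f\<in>F. f \<sqsubseteq>\<^bsub>Hom Q X Y\<^esub> h)"
proof -
  interpret L: complete_lattice "Hom Q X Y" by (rule Hom_complete_lattice) fact+
  show ?thesis
    using assms L.sup_least Sup_upper Sup_closed by (meson L.le_trans subsetD)
qed

lemma Sup_singleton:
  assumes "X \<in> Ob Q" "Y \<in> Ob Q" "f \<in> carrier (Hom Q X Y)"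
  shows "\<Squnion>\<^bsub>Hom Q X Y\<^esub> {f} = f"
proof -
  interpret L: complete_lattice "Hom Q X Y" by (rule Hom_complete_lattice) fact+
  show ?thesis using assms by simp
qed

lemma comp_mono_right:
  assumes "X \<in> Ob Q" "Y \<in> Ob Q" "Z \<in> Ob Q"
    and "f \<in> carrier (Hom Q X Y)" "f' \<in> carrier (Hom Q X Y)" "g \<in> carrier (Hom Q Y Z)"
    and "f \<sqsubseteq>\<^bsub>Hom Q X Y\<^esub> f'"
  shows "qcomp Q X Y Z g f \<sqsubseteq>\<^bsub>Hom Q X Z\<^esub> qcomp Q X Y Z g f'"
proof -
  have "\<Squnion>\<^bsub>Hom Q X Y\<^esub> {f, f'} = f'"
    using assms Sup_upper[of f' "{f, f'}"] by (intro hom_antisym) (auto simp: Sup_le_iff Sup_closed hom_refl)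
  then have "qcomp Q X Y Z g f' = \<Squnion>\<^bsub>Hom Q X Z\<^esub> {qcomp Q X Y Z g f, qcomp Q X Y Z g f'}"
    using comp_Sup_right[of X Y Z "{f, f'}" g] assms by simp
  then show ?thesis
    using assms Sup_upper[of "qcomp Q X Y Z g f" "{qcomp Q X Y Z g f, qcomp Q X Y Z g f'}" X Z]
    by (simp add: comp_closed)
qed

lemma comp_mono_left:
  assumes "X \<in> Ob Q" "Y \<in> Ob Q" "Z \<in> Ob Q"
    and "f \<in> carrier (Hom Q X Y)" "g \<in> carrier (Hom Q Y Z)" "g' \<in> carrier (Hom Q Y Z)"
    and "g \<sqsubseteq>\<^bsub>Hom Q Y Z\<^esub> g'"
  shows "qcomp Q X Y Z g f \<sqsubseteq>\<^bsub>Hom Q X Z\<^esub> qcomp Q X Y Z g' f"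
proof -
  have "\<Squnion>\<^bsub>Hom Q Y Z\<^esub> {g, g'} = g'"
    using assms Sup_upper[of g' "{g, g'}"] by (intro hom_antisym) (auto simp: Sup_le_iff Sup_closed hom_refl)
  then have "qcomp Q X Y Z g' f = \<Squnion>\<^bsub>Hom Q X Z\<^esub> {qcomp Q X Y Z g f, qcomp Q X Y Z g' f}"
    using comp_Sup_left[of X Y Z f "{g, g'}"] assms by simp
  then show ?thesis
    using assms Sup_upper[of "qcomp Q X Y Z g f" "{qcomp Q X Y Z g f, qcomp Q X Y Z g' f}" X Z]
    by (simp add: comp_closed)
qed

lemma comp_Sup_right_le_iff:
  assumes "X \<in> Ob Q" "Y \<in> Ob Q" "Z \<in> Ob Q"
    and "F \<subseteq> carrier (Hom Q X Y)" "g \<in> carrier (Hom Q Y Z)" "h \<in> carrier (Hom Q X Z)"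
  shows "qcomp Q X Y Z g (\<Squnion>\<^bsub>Hom Q X Y\<^esub> F) \<sqsubseteq>\<^bsub>Hom Q X Z\<^esub> h
    \<longleftrightarrow> (\<forall>f\<in>F. qcomp Q X Y Z g f \<sqsubseteq>\<^bsub>Hom Q X Z\<^esub> h)"
proof -
  have "(\<lambda>f. qcomp Q X Y Z g f) ` F \<subseteq> carrier (Hom Q X Z)"
    using assms comp_closed by blast
  then show ?thesis
    using assms by (simp add: comp_Sup_right Sup_le_iff)
qed

lemma comp_Sup_left_le_iff:
  assumes "X \<in> Ob Q" "Y \<in> Ob Q" "Z \<in> Ob Q"
    and "f \<in> carrier (Hom Q X Y)" "G \<subseteq> carrier (Hom Q Y Z)" "h \<in> carrier (Hom Q X Z)"
  shows "qcomp Q X Y Z (\<Squnion>\<^bsub>Hom Q Y Z\<^esub> G) f \<sqsubseteq>\<^bsub>Hom Q X Z\<^esub> h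
    \<longleftrightarrow> (\<forall>g\<in>G. qcomp Q X Y Z g f \<sqsubseteq>\<^bsub>Hom Q X Z\<^esub> h)"
proof -
  have "(\<lambda>g. qcomp Q X Y Z g f) ` G \<subseteq> carrier (Hom Q X Z)"
    using assms comp_closed by blast
  then show ?thesis
    using assms by (simp add: comp_Sup_left Sup_le_iff)
qed

text \<open>
  The unit of an adjunction bounds an identity by a join of composites. To bound \<open>k\<close> it is then
  enough to bound each \<open>f \<circ> k\<close>, since \<open>k = 1 \<circ> k \<le> \<Squnion>F \<circ> k\<close>.
\<close>

lemma le_by_unit:
  assumes unit: "ide Q Z \<sqsubseteq>\<^bsub>Hom Q Z Z\<^esub> \<Squnion>\<^bsub>Hom Q Z Z\<^esub> F"
    and "X \<in> Ob Q" "Z \<in> Ob Q" "F \<subseteq> carrier (Hom Q Z Z)"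
    and "k \<in> carrier (Hom Q X Z)" "h \<in> carrier (Hom Q X Z)"
    and "\<And>f. f \<in> F \<Longrightarrow> qcomp Q X Z Z f k \<sqsubseteq>\<^bsub>Hom Q X Z\<^esub> h"
  shows "k \<sqsubseteq>\<^bsub>Hom Q X Z\<^esub> h"
proof -
  have "qcomp Q X Z Z (ide Q Z) k \<sqsubseteq>\<^bsub>Hom Q X Z\<^esub> qcomp Q X Z Z (\<Squnion>\<^bsub>Hom Q Z Z\<^esub> F) k"
    using assms by (intro comp_mono_left) (auto simp: ide_closed Sup_closed)
  moreover have "qcomp Q X Z Z (\<Squnion>\<^bsub>Hom Q Z Z\<^esub> F) k \<sqsubseteq>\<^bsub>Hom Q X Z\<^esub> h"
    using assms by (simp add: comp_Sup_left_le_iff)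
  ultimately show ?thesis
    using assms hom_trans[of X Z k "qcomp Q X Z Z (\<Squnion>\<^bsub>Hom Q Z Z\<^esub> F) k" h]
    by (simp add: comp_ide_left comp_closed Sup_closed)
qed

end

section \<open>Distributors and adjunctions by components\<close>

lemma star_simps [simp]:
  "obj (star Q X) = {()}" "type_of (star Q X) u = X" "arr (star Q X) u v = ide Q X"
  by (auto simp: star_def)

lemma extensional_unit [simp]: "extensional {()} = UNIV"
  by (auto simp: extensional_def)

lemma Dist_le_iff:
  "\<phi> \<sqsubseteq>\<^bsub>Dist Q A B\<^esub> \<psi> \<longleftrightarrow>
    (\<forall>x\<in>obj A. \<forall>y\<in>obj B. \<phi> x y \<sqsubseteq>\<^bsub>Hom Q (type_of A x) (type_of B y)\<^esub> \<psi> x y)"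
  by (simp add: Dist_def)

lemma Dist_I:
  assumes "\<phi> \<in> (\<Pi>\<^sub>E x\<in>obj A. \<Pi>\<^sub>E y\<in>obj B. carrier (Hom Q (type_of A x) (type_of B y)))"
    and "\<And>x y' y. \<lbrakk>x \<in> obj A; y' \<in> obj B; y \<in> obj B\<rbrakk> \<Longrightarrow>
      qcomp Q (type_of A x) (type_of B y') (type_of B y) (arr B y' y) (\<phi> x y')
        \<sqsubseteq>\<^bsub>Hom Q (type_of A x) (type_of B y)\<^esub> \<phi> x y"
    and "\<And>x x' y. \<lbrakk>x \<in> obj A; x' \<in> obj A; y \<in> obj B\<rbrakk> \<Longrightarrow>
      qcomp Q (type_of A x) (type_of A x') (type_of B y) (\<phi> x' y) (arr A x x')
        \<sqsubseteq>\<^bsub>Hom Q (type_of A x) (type_of B y)\<^esub> \<phi> x y"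
  shows "\<phi> \<in> carrier (Dist Q A B)"
  using assms by (simp add: Dist_def)

lemma Dist_D:
  assumes "\<phi> \<in> carrier (Dist Q A B)"
  shows Dist_PiE: "\<phi> \<in> (\<Pi>\<^sub>E x\<in>obj A. \<Pi>\<^sub>E y\<in>obj B. carrier (Hom Q (type_of A x) (type_of B y)))"
    and Dist_closed: "\<lbrakk>x \<in> obj A; y \<in> obj B\<rbrakk>
      \<Longrightarrow> \<phi> x y \<in> carrier (Hom Q (type_of A x) (type_of B y))"
    and Dist_left: "\<lbrakk>x \<in> obj A; y' \<in> obj B; y \<in> obj B\<rbrakk> \<Longrightarrow>
      qcomp Q (type_of A x) (type_of B y') (type_of B y) (arr B y' y) (\<phi> x y')
        \<sqsubseteq>\<^bsub>Hom Q (type_of A x) (type_of B y)\<^esub> \<phi> x y"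
    and Dist_right: "\<lbrakk>x \<in> obj A; x' \<in> obj A; y \<in> obj B\<rbrakk> \<Longrightarrow>
      qcomp Q (type_of A x) (type_of A x') (type_of B y) (\<phi> x' y) (arr A x x')
        \<sqsubseteq>\<^bsub>Hom Q (type_of A x) (type_of B y)\<^esub> \<phi> x y"
  using assms by (auto simp: Dist_def)

context quantaloid
begin

lemma qcategory_star: "X \<in> Ob Q \<Longrightarrow> qcategory Q (star Q X)"
  by unfold_locales (auto simp: ide_closed hom_refl comp_ide_left)

lemma Dist_star_star_iff:
  assumes "X \<in> Ob Q" "Y \<in> Ob Q"
  shows "f \<in> carrier (Dist Q (star Q X) (star Q Y)) \<longleftrightarrow> f () () \<in> carrier (Hom Q X Y)"
  using assms by (auto simp: Dist_def comp_ide_left comp_ide_right hom_refl PiE_def)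

lemma Dist_star_star_le_iff:
  "f \<sqsubseteq>\<^bsub>Dist Q (star Q X) (star Q Y)\<^esub> g \<longleftrightarrow> f () () \<sqsubseteq>\<^bsub>Hom Q X Y\<^esub> g () ()"
  by (simp add: Dist_le_iff)

lemma dist_comp_closed_set:
  assumes "qcategory Q A" "qcategory Q B" "qcategory Q C"
    and "\<phi> \<in> carrier (Dist Q A B)" "\<psi> \<in> carrier (Dist Q B C)" "x \<in> obj A" "z \<in> obj C"
  shows "(\<lambda>y. qcomp Q (type_of A x) (type_of B y) (type_of C z) (\<psi> y z) (\<phi> x y)) ` obj B
    \<subseteq> carrier (Hom Q (type_of A x) (type_of C z))"
  using assms by (auto intro!: comp_closed simp: Dist_closed qcategory.type_of_closed)

text \<open>
  The counit is an inequality out of a join, hence a family of inequalities between arrows; the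
  unit has to stay an inequality into a join.
\<close>

lemma left_adjoint_dist_iff:
  assumes A: "qcategory Q A" and B: "qcategory Q B"
  shows "left_adjoint_dist Q B A \<phi> \<longleftrightarrow>
    \<phi> \<in> carrier (Dist Q B A) \<and>
    (\<exists>\<psi> \<in> carrier (Dist Q A B).
      (\<forall>b\<in>obj B. \<forall>b'\<in>obj B. arr B b b' \<sqsubseteq>\<^bsub>Hom Q (type_of B b) (type_of B b')\<^esub>
        \<Squnion>\<^bsub>Hom Q (type_of B b) (type_of B b')\<^esub>
          ((\<lambda>y. qcomp Q (type_of B b) (type_of A y) (type_of B b') (\<psi> y b') (\<phi> b y)) ` obj A)) \<and>
      (\<forall>b\<in>obj B. \<forall>x\<in>obj A. \<forall>y\<in>obj A.
        qcomp Q (type_of A x) (type_of B b) (type_of A y) (\<phi> b y) (\<psi> x b)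
          \<sqsubseteq>\<^bsub>Hom Q (type_of A x) (type_of A y)\<^esub> arr A x y))"
proof -
  have "dist_comp Q A B A \<phi> \<psi> \<sqsubseteq>\<^bsub>Dist Q A A\<^esub> dist_id A \<longleftrightarrow>
      (\<forall>b\<in>obj B. \<forall>x\<in>obj A. \<forall>y\<in>obj A.
        qcomp Q (type_of A x) (type_of B b) (type_of A y) (\<phi> b y) (\<psi> x b)
          \<sqsubseteq>\<^bsub>Hom Q (type_of A x) (type_of A y)\<^esub> arr A x y)"
    if "\<phi> \<in> carrier (Dist Q B A)" "\<psi> \<in> carrier (Dist Q A B)" for \<psi>
  proof -
    have "(dist_comp Q A B A \<phi> \<psi> x y \<sqsubseteq>\<^bsub>Hom Q (type_of A x) (type_of A y)\<^esub> dist_id A x y) \<longleftrightarrow>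
        (\<forall>b\<in>obj B. qcomp Q (type_of A x) (type_of B b) (type_of A y) (\<phi> b y) (\<psi> x b)
          \<sqsubseteq>\<^bsub>Hom Q (type_of A x) (type_of A y)\<^esub> arr A x y)"
      if xy: "x \<in> obj A" "y \<in> obj A" for x y
      using xy dist_comp_closed_set[OF A B A \<open>\<psi> \<in> _\<close> \<open>\<phi> \<in> _\<close> xy]
      by (simp add: dist_comp_def dist_id_def Sup_le_iff qcategory.arr_closed[OF A]
          qcategory.type_of_closed[OF A])
    then show ?thesis by (auto simp: Dist_le_iff)
  qed
  moreover have "dist_id B \<sqsubseteq>\<^bsub>Dist Q B B\<^esub> dist_comp Q B A B \<psi> \<phi> \<longleftrightarrow>
      (\<forall>b\<in>obj B. \<forall>b'\<in>obj B. arr B b b' \<sqsubseteq>\<^bsub>Hom Q (type_of B b) (type_of B b')\<^esub>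
        \<Squnion>\<^bsub>Hom Q (type_of B b) (type_of B b')\<^esub>
          ((\<lambda>y. qcomp Q (type_of B b) (type_of A y) (type_of B b') (\<psi> y b') (\<phi> b y)) ` obj A))"
    for \<psi>
    by (simp add: Dist_le_iff dist_comp_def dist_id_def)
  ultimately show ?thesis
    unfolding left_adjoint_dist_def by (intro conj_cong bex_cong refl) simp
qed

lemma left_adjoint_star_iff:
  assumes "qcategory Q A" "X \<in> Ob Q"
  shows "left_adjoint_dist Q (star Q X) A \<phi> \<longleftrightarrow>
    \<phi> \<in> carrier (Dist Q (star Q X) A) \<and>
    (\<exists>\<psi> \<in> carrier (Dist Q A (star Q X)).
      ide Q X \<sqsubseteq>\<^bsub>Hom Q X X\<^esub>
        \<Squnion>\<^bsub>Hom Q X X\<^esub> ((\<lambda>y. qcomp Q X (type_of A y) X (\<psi> y ()) (\<phi> () y)) ` obj A) \<and>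
      (\<forall>x\<in>obj A. \<forall>y\<in>obj A.
        qcomp Q (type_of A x) X (type_of A y) (\<phi> () y) (\<psi> x ())
          \<sqsubseteq>\<^bsub>Hom Q (type_of A x) (type_of A y)\<^esub> arr A x y))"
  using left_adjoint_dist_iff[OF assms(1) qcategory_star[OF assms(2)]] by simp

lemma row_in_Dist:
  assumes "qcategory Q A" "qcategory Q B" "\<phi> \<in> carrier (Dist Q B A)" "b \<in> obj B"
  shows "(\<lambda>_. \<phi> b) \<in> carrier (Dist Q (star Q (type_of B b)) A)"
proof (rule Dist_I, goal_cases)
  case 1
  then show ?case using Dist_PiE[OF assms(3)] assms(4) by (auto simp: PiE_def)
next
  case (2 x y' y)
  then show ?case using assms by (simp add: Dist_left)
next
  case (3 x x' y)
  then show ?case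
    using assms by (simp add: Dist_closed comp_ide_right hom_refl qcategory.type_of_closed)
qed

text \<open>
  Right adjoints of the rows assemble to a distributor because a right adjoint is determined by
  its left adjoint: the action of \<open>B\<close> on the rows of \<open>\<phi>\<close> transfers to the right adjoints by
  inserting the unit of the target row and cancelling with the counit of the source row. The
  unit of the whole arises from the units of the rows in the same way.
\<close>

lemma left_adjoint_dist_iff_rows:
  assumes A: "qcategory Q A" and B: "qcategory Q B" and \<phi>: "\<phi> \<in> carrier (Dist Q B A)"
  shows "left_adjoint_dist Q B A \<phi> \<longleftrightarrow>
    (\<forall>b\<in>obj B. left_adjoint_dist Q (star Q (type_of B b)) A (\<lambda>_. \<phi> b))"
    (is "?whole \<longleftrightarrow> ?rows")
proof
  interpret A: qcategory Q A by (rule A)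
  interpret B: qcategory Q B by (rule B)
  note types = A.type_of_closed B.type_of_closed
  {
    assume ?whole
    then obtain \<psi> where \<psi>: "\<psi> \<in> carrier (Dist Q A B)"
      and unit: "\<And>b b'. \<lbrakk>b \<in> obj B; b' \<in> obj B\<rbrakk> \<Longrightarrow>
        arr B b b' \<sqsubseteq>\<^bsub>Hom Q (type_of B b) (type_of B b')\<^esub>
        \<Squnion>\<^bsub>Hom Q (type_of B b) (type_of B b')\<^esub>
          ((\<lambda>y. qcomp Q (type_of B b) (type_of A y) (type_of B b') (\<psi> y b') (\<phi> b y)) ` obj A)"
      and counit: "\<And>b x y. \<lbrakk>b \<in> obj B; x \<in> obj A; y \<in> obj A\<rbrakk> \<Longrightarrow>
        qcomp Q (type_of A x) (type_of B b) (type_of A y) (\<phi> b y) (\<psi> x b)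
          \<sqsubseteq>\<^bsub>Hom Q (type_of A x) (type_of A y)\<^esub> arr A x y"
      unfolding left_adjoint_dist_iff[OF A B] by blast
    show ?rows
    proof
      fix b assume b: "b \<in> obj B"
      define \<psi>b where "\<psi>b = (\<lambda>x\<in>obj A. \<lambda>_::unit. \<psi> x b)"
      have "\<psi>b \<in> carrier (Dist Q A (star Q (type_of B b)))"
        unfolding \<psi>b_def using b \<psi>
        by (intro Dist_I)
          (auto simp: PiE_def types Dist_closed[OF \<psi>] Dist_right[OF \<psi>] comp_ide_left hom_refl)
      moreover have "ide Q (type_of B b) \<sqsubseteq>\<^bsub>Hom Q (type_of B b) (type_of B b)\<^esub>
        \<Squnion>\<^bsub>Hom Q (type_of B b) (type_of B b)\<^esub> ((\<lambda>y. qcomp Q (type_of B b) (type_of A y)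
          (type_of B b) (\<psi>b y ()) (\<phi> b y)) ` obj A)"
        using hom_trans[OF B.arr_refl[OF b] unit[OF b b]] b
          dist_comp_closed_set[OF B A B \<phi> \<psi> b b]
        by (simp add: \<psi>b_def types ide_closed B.arr_closed Sup_closed cong: image_cong)
      ultimately show "left_adjoint_dist Q (star Q (type_of B b)) A (\<lambda>_. \<phi> b)"
        unfolding left_adjoint_star_iff[OF A B.type_of_closed[OF b]]
        using row_in_Dist[OF A B \<phi> b] counit[OF b]
        by (intro conjI bexI[of _ \<psi>b]) (auto simp: \<psi>b_def)
    qed
  }
  assume ?rows
  let ?right = "\<lambda>b \<psi>. \<psi> \<in> carrier (Dist Q A (star Q (type_of B b))) \<and>
      ide Q (type_of B b) \<sqsubseteq>\<^bsub>Hom Q (type_of B b) (type_of B b)\<^esub>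
        \<Squnion>\<^bsub>Hom Q (type_of B b) (type_of B b)\<^esub> ((\<lambda>y. qcomp Q (type_of B b) (type_of A y)
          (type_of B b) (\<psi> y ()) (\<phi> b y)) ` obj A) \<and>
      (\<forall>x\<in>obj A. \<forall>y\<in>obj A.
        qcomp Q (type_of A x) (type_of B b) (type_of A y) (\<phi> b y) (\<psi> x ())
          \<sqsubseteq>\<^bsub>Hom Q (type_of A x) (type_of A y)\<^esub> arr A x y)"
  from \<open>?rows\<close> have "\<forall>b\<in>obj B. \<exists>\<psi>. ?right b \<psi>"
    by (simp add: left_adjoint_star_iff[OF A] types Bex_def)
  from bchoice[OF this] obtain \<psi> where right: "\<forall>b\<in>obj B. ?right b (\<psi> b)" by blast
  have \<psi>: "\<psi> b \<in> carrier (Dist Q A (star Q (type_of B b)))" if "b \<in> obj B" for b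
    using right that by blast
  have unit: "ide Q (type_of B b) \<sqsubseteq>\<^bsub>Hom Q (type_of B b) (type_of B b)\<^esub>
      \<Squnion>\<^bsub>Hom Q (type_of B b) (type_of B b)\<^esub> ((\<lambda>y. qcomp Q (type_of B b) (type_of A y)
        (type_of B b) (\<psi> b y ()) (\<phi> b y)) ` obj A)" if "b \<in> obj B" for b
    using right that by blast
  have counit: "qcomp Q (type_of A x) (type_of B b) (type_of A y) (\<phi> b y) (\<psi> b x ())
      \<sqsubseteq>\<^bsub>Hom Q (type_of A x) (type_of A y)\<^esub> arr A x y"
    if "b \<in> obj B" "x \<in> obj A" "y \<in> obj A" for b x y
    using right that by blast
  have \<psi>_closed: "\<psi> b x () \<in> carrier (Hom Q (type_of A x) (type_of B b))"
    if "b \<in> obj B" "x \<in> obj A" for b x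
    using Dist_closed[OF \<psi>] that by simp
  note \<phi>_closed = Dist_closed[OF \<phi>]
  note closed = comp_closed types \<phi>_closed \<psi>_closed A.arr_closed B.arr_closed
  have unit_closed: "(\<lambda>y. qcomp Q (type_of B b) (type_of A y) (type_of B b) (\<psi> b y ()) (\<phi> b y))
      ` obj A \<subseteq> carrier (Hom Q (type_of B b) (type_of B b))"
    if "b \<in> obj B" for b
    using that by (auto simp: closed)
  have unit_step: "qcomp Q (type_of B b) (type_of B b') (type_of B b')
        (qcomp Q (type_of B b') (type_of A y) (type_of B b') (\<psi> b' y ()) (\<phi> b' y)) (arr B b b')
      \<sqsubseteq>\<^bsub>Hom Q (type_of B b) (type_of B b')\<^esub>
        qcomp Q (type_of B b) (type_of A y) (type_of B b') (\<psi> b' y ()) (\<phi> b y)"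
    if "b \<in> obj B" "b' \<in> obj B" "y \<in> obj A" for b b' y
    using that by (simp add: comp_assoc closed comp_mono_right Dist_right[OF \<phi>])
  have action: "qcomp Q (type_of A x) (type_of B b) (type_of B b') (arr B b b') (\<psi> b x ())
      \<sqsubseteq>\<^bsub>Hom Q (type_of A x) (type_of B b')\<^esub> \<psi> b' x ()"
    if b: "b \<in> obj B" and b': "b' \<in> obj B" and x: "x \<in> obj A" for b b' x
  proof (rule le_by_unit[OF unit[OF b']])
    fix f
    assume "f \<in> (\<lambda>y. qcomp Q (type_of B b') (type_of A y) (type_of B b') (\<psi> b' y ()) (\<phi> b' y))
      ` obj A"
    then obtain y where y: "y \<in> obj A"
      and f: "f = qcomp Q (type_of B b') (type_of A y) (type_of B b') (\<psi> b' y ()) (\<phi> b' y)"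
      by blast
    let ?X = "type_of A x" and ?Y = "type_of A y" and ?b = "type_of B b" and ?b' = "type_of B b'"
    have "qcomp Q ?X ?b' ?b' f (qcomp Q ?X ?b ?b' (arr B b b') (\<psi> b x ()))
        = qcomp Q ?X ?b ?b' (qcomp Q ?b ?b' ?b' f (arr B b b')) (\<psi> b x ())"
      using b b' x y by (simp add: f comp_assoc closed)
    also have "\<dots> \<sqsubseteq>\<^bsub>Hom Q ?X ?b'\<^esub>
        qcomp Q ?X ?b ?b' (qcomp Q ?b ?Y ?b' (\<psi> b' y ()) (\<phi> b y)) (\<psi> b x ())"
      unfolding f using b b' x y by (intro comp_mono_left unit_step) (simp_all add: closed)
    also have "\<dots> = qcomp Q ?X ?Y ?b' (\<psi> b' y ()) (qcomp Q ?X ?b ?Y (\<phi> b y) (\<psi> b x ()))"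
      using b b' x y by (simp add: comp_assoc closed)
    also have "\<dots> \<sqsubseteq>\<^bsub>Hom Q ?X ?b'\<^esub> qcomp Q ?X ?Y ?b' (\<psi> b' y ()) (arr A x y)"
      using b b' x y by (intro comp_mono_right counit) (simp_all add: closed)
    also have "\<dots> \<sqsubseteq>\<^bsub>Hom Q ?X ?b'\<^esub> \<psi> b' x ()"
      using Dist_right[OF \<psi>[OF b'] x y] by simp
    finally show "qcomp Q ?X ?b' ?b' f (qcomp Q ?X ?b ?b' (arr B b b') (\<psi> b x ()))
        \<sqsubseteq>\<^bsub>Hom Q ?X ?b'\<^esub> \<psi> b' x ()"
      using b b' x y by (simp add: f closed)
  qed (use b b' x unit_closed in \<open>simp_all add: closed\<close>)
  define \<Psi> where "\<Psi> = (\<lambda>x\<in>obj A. \<lambda>b\<in>obj B. \<psi> b x ())"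
  have "\<Psi> \<in> carrier (Dist Q A B)"
    unfolding \<Psi>_def using Dist_right[OF \<psi>] by (intro Dist_I) (auto simp: closed action)
  moreover have "arr B b b' \<sqsubseteq>\<^bsub>Hom Q (type_of B b) (type_of B b')\<^esub>
      \<Squnion>\<^bsub>Hom Q (type_of B b) (type_of B b')\<^esub>
        ((\<lambda>y. qcomp Q (type_of B b) (type_of A y) (type_of B b') (\<psi> b' y ()) (\<phi> b y)) ` obj A)"
    if b: "b \<in> obj B" and b': "b' \<in> obj B" for b b'
  proof -
    let ?S = "(\<lambda>y. qcomp Q (type_of B b) (type_of A y) (type_of B b') (\<psi> b' y ()) (\<phi> b y)) ` obj A"
    have S: "?S \<subseteq> carrier (Hom Q (type_of B b) (type_of B b'))"
      using b b' by (auto simp: closed)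
    show ?thesis
    proof (rule le_by_unit[OF unit[OF b']])
      fix f
      assume "f \<in> (\<lambda>y. qcomp Q (type_of B b') (type_of A y) (type_of B b') (\<psi> b' y ()) (\<phi> b' y))
        ` obj A"
      then obtain y where y: "y \<in> obj A"
        and f: "f = qcomp Q (type_of B b') (type_of A y) (type_of B b') (\<psi> b' y ()) (\<phi> b' y)"
        by blast
      show "qcomp Q (type_of B b) (type_of B b') (type_of B b') f (arr B b b')
          \<sqsubseteq>\<^bsub>Hom Q (type_of B b) (type_of B b')\<^esub> \<Squnion>\<^bsub>Hom Q (type_of B b) (type_of B b')\<^esub> ?S"
        unfolding f
        by (rule hom_trans[OF unit_step[OF b b' y] Sup_upper])
          (use b b' y S in \<open>simp_all add: closed Sup_closed\<close>)
    qed (use b b' S unit_closed in \<open>simp_all add: closed Sup_closed\<close>)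
  qed
  ultimately show ?whole
    unfolding left_adjoint_dist_iff[OF A B] using \<phi> counit
    by (intro conjI bexI[of _ \<Psi>]) (auto simp: \<Psi>_def cong: image_cong)
qed

lemma Dist_partial_order:
  assumes "qcategory Q A" "qcategory Q B"
  shows "partial_order (Dist Q A B)"
proof
  fix \<phi> \<psi> assume le: "\<phi> \<sqsubseteq>\<^bsub>Dist Q A B\<^esub> \<psi>" "\<psi> \<sqsubseteq>\<^bsub>Dist Q A B\<^esub> \<phi>"
    and mem: "\<phi> \<in> carrier (Dist Q A B)" "\<psi> \<in> carrier (Dist Q A B)"
  have "\<phi> x y = \<psi> x y" if "x \<in> obj A" "y \<in> obj B" for x y
    using le mem that assms
    by (intro hom_antisym) (auto simp: Dist_le_iff Dist_closed qcategory.type_of_closed)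
  then have "\<phi> x = \<psi> x" if "x \<in> obj A" for x
    using that Dist_PiE[OF mem(1)] Dist_PiE[OF mem(2)] by (intro PiE_ext[of _ "obj B"]) auto
  then have "\<phi> = \<psi>"
    using PiE_ext[OF Dist_PiE[OF mem(1)] Dist_PiE[OF mem(2)]] by blast
  then show "\<phi> .=\<^bsub>Dist Q A B\<^esub> \<psi>" by (simp add: Dist_def)
next
  fix \<phi> \<psi> \<chi> assume "\<phi> \<sqsubseteq>\<^bsub>Dist Q A B\<^esub> \<psi>" "\<psi> \<sqsubseteq>\<^bsub>Dist Q A B\<^esub> \<chi>" "\<phi> \<in> carrier (Dist Q A B)"
    "\<psi> \<in> carrier (Dist Q A B)" "\<chi> \<in> carrier (Dist Q A B)"
  then show "\<phi> \<sqsubseteq>\<^bsub>Dist Q A B\<^esub> \<chi>"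
    using assms unfolding Dist_le_iff
    by (meson hom_trans Dist_closed qcategory.type_of_closed)
next
  fix \<phi> assume "\<phi> \<in> carrier (Dist Q A B)"
  then show "\<phi> \<sqsubseteq>\<^bsub>Dist Q A B\<^esub> \<phi>"
    using assms by (auto simp: Dist_le_iff hom_refl Dist_closed qcategory.type_of_closed)
qed (auto simp: Dist_def)

text \<open>
  A meet of distributors is recognised by the arrows below its components. This suits implications,
  which are known through exactly these arrows.
\<close>

lemma Dist_Inf_eqI:
  assumes A: "qcategory Q A" and B: "qcategory Q B"
    and \<phi>: "\<phi> \<in> carrier (Dist Q B A)"
    and D: "\<And>i. i \<in> I \<Longrightarrow> D i \<in> carrier (Dist Q B A)"
    and below: "\<And>b y g. \<lbrakk>b \<in> obj B; y \<in> obj A; g \<in> carrier (Hom Q (type_of B b) (type_of A y))\<rbrakk>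
      \<Longrightarrow> g \<sqsubseteq>\<^bsub>Hom Q (type_of B b) (type_of A y)\<^esub> \<phi> b y \<longleftrightarrow>
        (\<forall>i\<in>I. g \<sqsubseteq>\<^bsub>Hom Q (type_of B b) (type_of A y)\<^esub> D i b y)"
  shows "\<Sqinter>\<^bsub>Dist Q B A\<^esub> (D ` I) = \<phi>"
proof -
  interpret P: partial_order "Dist Q B A" by (rule Dist_partial_order) fact+
  have le_iff: "\<psi> \<sqsubseteq>\<^bsub>Dist Q B A\<^esub> \<phi> \<longleftrightarrow> (\<forall>i\<in>I. \<psi> \<sqsubseteq>\<^bsub>Dist Q B A\<^esub> D i)"
    if "\<psi> \<in> carrier (Dist Q B A)" for \<psi>
    using below Dist_closed[OF that] by (simp add: Dist_le_iff) blast
  have "greatest (Dist Q B A) \<phi> (Lower (Dist Q B A) (D ` I))"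
    using \<phi> D le_iff[OF \<phi>] le_iff by (intro greatest_LowerI) (auto simp: Lower_def)
  then show ?thesis
    unfolding inf_def by (rule someI2) (auto intro: P.greatest_unique)
qed

section \<open>Presheaf categories\<close>

text \<open>
  The homs of \<open>\<P>A\<close> are given as implications, that is, by a description operator. They exist,
  as the join of all arrows \<open>g\<close> with \<open>g \<circ> \<mu> \<le> \<mu>'\<close>, and are used only through this universal
  property.
\<close>

lemma presheaf_hom:
  assumes A: "qcategory Q A" and X: "X \<in> Ob Q" and X': "X' \<in> Ob Q"
    and \<mu>: "\<mu> \<in> carrier (Dist Q A (star Q X))" and \<mu>': "\<mu>' \<in> carrier (Dist Q A (star Q X'))"
  shows presheaf_hom_closed: "arr (presheaf_cat Q A) (X, \<mu>) (X', \<mu>') \<in> carrier (Hom Q X X')"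
    and presheaf_hom_le_iff: "g \<in> carrier (Hom Q X X') \<Longrightarrow>
      g \<sqsubseteq>\<^bsub>Hom Q X X'\<^esub> arr (presheaf_cat Q A) (X, \<mu>) (X', \<mu>') \<longleftrightarrow>
      (\<forall>x\<in>obj A. qcomp Q (type_of A x) X X' g (\<mu> x ()) \<sqsubseteq>\<^bsub>Hom Q (type_of A x) X'\<^esub> \<mu>' x ())"
proof -
  interpret A: qcategory Q A by (rule A)
  have closed: "\<mu> x () \<in> carrier (Hom Q (type_of A x) X)"
      "\<mu>' x () \<in> carrier (Hom Q (type_of A x) X')" if "x \<in> obj A" for x
    using Dist_closed[OF \<mu> that] Dist_closed[OF \<mu>' that] by simp_all
  let ?below = "\<lambda>g. \<forall>x\<in>obj A.
    qcomp Q (type_of A x) X X' g (\<mu> x ()) \<sqsubseteq>\<^bsub>Hom Q (type_of A x) X'\<^esub> \<mu>' x ()"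
  let ?S = "{g \<in> carrier (Hom Q X X'). ?below g}"
  let ?k = "\<Squnion>\<^bsub>Hom Q X X'\<^esub> ?S"
  have S: "?S \<subseteq> carrier (Hom Q X X')" by blast
  have k: "?k \<in> carrier (Hom Q X X')" using X X' by (simp add: Sup_closed)
  have "?below ?k"
  proof
    fix x assume x: "x \<in> obj A"
    then show "qcomp Q (type_of A x) X X' ?k (\<mu> x ()) \<sqsubseteq>\<^bsub>Hom Q (type_of A x) X'\<^esub> \<mu>' x ()"
      by (subst comp_Sup_left_le_iff[OF A.type_of_closed[OF x] X X' closed(1)[OF x] S closed(2)[OF x]])
        auto
  qed
  have below_iff: "?below g \<longleftrightarrow> g \<sqsubseteq>\<^bsub>Hom Q X X'\<^esub> ?k" if g: "g \<in> carrier (Hom Q X X')" for g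
  proof
    assume "?below g"
    then show "g \<sqsubseteq>\<^bsub>Hom Q X X'\<^esub> ?k" using g X X' S by (intro Sup_upper) auto
  next
    assume le: "g \<sqsubseteq>\<^bsub>Hom Q X X'\<^esub> ?k"
    show "?below g"
    proof
      fix x assume x: "x \<in> obj A"
      show "qcomp Q (type_of A x) X X' g (\<mu> x ()) \<sqsubseteq>\<^bsub>Hom Q (type_of A x) X'\<^esub> \<mu>' x ()"
        by (rule hom_trans[OF comp_mono_left[OF _ X X' _ g k le] \<open>?below ?k\<close>[rule_format, OF x]])
          (use x X X' g k in \<open>simp_all add: closed A.type_of_closed comp_closed\<close>)
    qed
  qed
  have comp_iff: "dist_comp Q A (star Q X) (star Q X') g \<mu> \<sqsubseteq>\<^bsub>Dist Q A (star Q X')\<^esub> \<mu>'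
      \<longleftrightarrow> ?below (g () ())" if "g () () \<in> carrier (Hom Q X X')" for g
    using that X X'
    by (auto simp: Dist_le_iff dist_comp_def Sup_singleton comp_closed closed A.type_of_closed)
  have "dist_impl Q A (star Q X) (star Q X') \<mu>' \<mu> = (\<lambda>_ _. ?k)"
    unfolding dist_impl_def
  proof (rule the_equality)
    show "(\<lambda>_ _. ?k) \<in> carrier (Dist Q (star Q X) (star Q X')) \<and>
      (\<forall>g\<in>carrier (Dist Q (star Q X) (star Q X')).
        dist_comp Q A (star Q X) (star Q X') g \<mu> \<sqsubseteq>\<^bsub>Dist Q A (star Q X')\<^esub> \<mu>' \<longleftrightarrow>
        g \<sqsubseteq>\<^bsub>Dist Q (star Q X) (star Q X')\<^esub> (\<lambda>_ _. ?k))"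
      using X X' k by (simp add: Dist_star_star_iff comp_iff below_iff Dist_star_star_le_iff)
  next
    fix l assume l: "l \<in> carrier (Dist Q (star Q X) (star Q X')) \<and>
      (\<forall>g\<in>carrier (Dist Q (star Q X) (star Q X')).
        dist_comp Q A (star Q X) (star Q X') g \<mu> \<sqsubseteq>\<^bsub>Dist Q A (star Q X')\<^esub> \<mu>' \<longleftrightarrow>
        g \<sqsubseteq>\<^bsub>Dist Q (star Q X) (star Q X')\<^esub> l)"
    then have l_closed: "l () () \<in> carrier (Hom Q X X')"
      and l_iff: "g \<sqsubseteq>\<^bsub>Hom Q X X'\<^esub> ?k \<longleftrightarrow> g \<sqsubseteq>\<^bsub>Hom Q X X'\<^esub> l () ()"
        if "g \<in> carrier (Hom Q X X')" for g
      using X X' that by (auto simp: Dist_star_star_iff comp_iff below_iff Dist_star_star_le_iff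
          dest!: bspec[where x = "\<lambda>_ _. g"])
    have "l () () = ?k"
      using l_iff[OF k] l_iff[OF l_closed] X X' k l_closed
      by (intro hom_antisym) (simp_all add: hom_refl)
    then show "l = (\<lambda>_ _. ?k)" by (intro ext) simp
  qed
  then have hom: "arr (presheaf_cat Q A) (X, \<mu>) (X', \<mu>') = ?k"
    by (simp add: presheaf_cat_def)
  show "arr (presheaf_cat Q A) (X, \<mu>) (X', \<mu>') \<in> carrier (Hom Q X X')"
    using hom k by simp
  show "g \<sqsubseteq>\<^bsub>Hom Q X X'\<^esub> arr (presheaf_cat Q A) (X, \<mu>) (X', \<mu>') \<longleftrightarrow> ?below g"
    if "g \<in> carrier (Hom Q X X')"
    using below_iff[OF that] hom by simp
qed

lemma presheaf_cat_simps [simp]: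
  "p \<in> obj (presheaf_cat Q A) \<longleftrightarrow> fst p \<in> Ob Q \<and> snd p \<in> carrier (Dist Q A (star Q (fst p)))"
  "type_of (presheaf_cat Q A) = fst"
  by (auto simp: presheaf_cat_def)

lemma ball_presheaf_iff:
  "(\<forall>p\<in>obj (presheaf_cat Q A). P p) \<longleftrightarrow>
    (\<forall>X\<in>Ob Q. \<forall>\<mu>\<in>carrier (Dist Q A (star Q X)). P (X, \<mu>))"
  by (auto simp: Ball_def)

lemma presheaf_hom_apply:
  assumes A: "qcategory Q A" and X: "X \<in> Ob Q" and X': "X' \<in> Ob Q"
    and \<mu>: "\<mu> \<in> carrier (Dist Q A (star Q X))" and \<mu>': "\<mu>' \<in> carrier (Dist Q A (star Q X'))"
    and x: "x \<in> obj A"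
  shows "qcomp Q (type_of A x) X X' (arr (presheaf_cat Q A) (X, \<mu>) (X', \<mu>')) (\<mu> x ())
    \<sqsubseteq>\<^bsub>Hom Q (type_of A x) X'\<^esub> \<mu>' x ()"
  using presheaf_hom_le_iff[OF A X X' \<mu> \<mu>' presheaf_hom_closed[OF A X X' \<mu> \<mu>']]
    hom_refl[OF X X' presheaf_hom_closed[OF A X X' \<mu> \<mu>']] x by blast

lemma qcategory_presheaf_cat:
  assumes A: "qcategory Q A"
  shows "qcategory Q (presheaf_cat Q A)"
proof (unfold_locales, goal_cases)
  case (1 p)
  then show ?case by simp
next
  case (2 p q)
  then show ?case using presheaf_hom_closed[OF A] by (cases p; cases q) simp
next
  case (3 p)
  obtain X \<mu> where p: "p = (X, \<mu>)" by (cases p)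
  have X: "X \<in> Ob Q" and \<mu>: "\<mu> \<in> carrier (Dist Q A (star Q X))" using 3 p by simp_all
  have "ide Q X \<sqsubseteq>\<^bsub>Hom Q X X\<^esub> arr (presheaf_cat Q A) (X, \<mu>) (X, \<mu>)"
    using Dist_left[OF \<mu>] by (simp add: presheaf_hom_le_iff[OF A X X \<mu> \<mu>] ide_closed X)
  then show ?case by (simp add: p)
next
  case (4 p q r)
  interpret A: qcategory Q A by (rule A)
  obtain X \<mu> Y \<nu> Z \<rho> where pqr: "p = (X, \<mu>)" "q = (Y, \<nu>)" "r = (Z, \<rho>)"
    by (cases p; cases q; cases r)
  have X: "X \<in> Ob Q" and \<mu>: "\<mu> \<in> carrier (Dist Q A (star Q X))"
    and Y: "Y \<in> Ob Q" and \<nu>: "\<nu> \<in> carrier (Dist Q A (star Q Y))"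
    and Z: "Z \<in> Ob Q" and \<rho>: "\<rho> \<in> carrier (Dist Q A (star Q Z))"
    using 4 pqr by simp_all
  let ?f = "arr (presheaf_cat Q A) (X, \<mu>) (Y, \<nu>)" and ?g = "arr (presheaf_cat Q A) (Y, \<nu>) (Z, \<rho>)"
  have f: "?f \<in> carrier (Hom Q X Y)" and g: "?g \<in> carrier (Hom Q Y Z)"
    by (rule presheaf_hom_closed; fact)+
  have "qcomp Q X Y Z ?g ?f \<sqsubseteq>\<^bsub>Hom Q X Z\<^esub> arr (presheaf_cat Q A) (X, \<mu>) (Z, \<rho>)"
  proof (subst presheaf_hom_le_iff[OF A X Z \<mu> \<rho> comp_closed[OF X Y Z f g]], rule ballI)
    fix x assume x: "x \<in> obj A"
    note x_closed = Dist_closed[OF \<mu> x, of "()", simplified] Dist_closed[OF \<nu> x, of "()", simplified]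
      Dist_closed[OF \<rho> x, of "()", simplified] A.type_of_closed[OF x]
    have "qcomp Q (type_of A x) X Z (qcomp Q X Y Z ?g ?f) (\<mu> x ())
        = qcomp Q (type_of A x) Y Z ?g (qcomp Q (type_of A x) X Y ?f (\<mu> x ()))"
      using X Y Z f g x_closed by (simp add: comp_assoc)
    also have "\<dots> \<sqsubseteq>\<^bsub>Hom Q (type_of A x) Z\<^esub> qcomp Q (type_of A x) Y Z ?g (\<nu> x ())"
      using X Y Z f g x_closed presheaf_hom_apply[OF A X Y \<mu> \<nu> x]
      by (intro comp_mono_right) (simp_all add: comp_closed)
    also have "\<dots> \<sqsubseteq>\<^bsub>Hom Q (type_of A x) Z\<^esub> \<rho> x ()"
      by (rule presheaf_hom_apply[OF A Y Z \<nu> \<rho> x])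
    finally show "qcomp Q (type_of A x) X Z (qcomp Q X Y Z ?g ?f) (\<mu> x ())
        \<sqsubseteq>\<^bsub>Hom Q (type_of A x) Z\<^esub> \<rho> x ()"
      using X Y Z f g x_closed by (simp add: comp_closed)
  qed
  then show ?case by (simp add: pqr)
qed

lemma cograph_in_Dist:
  assumes A: "qcategory Q A" and B: "qcategory Q B"
    and F: "\<And>x. x \<in> obj A \<Longrightarrow> F x \<in> obj B" "\<And>x. x \<in> obj A \<Longrightarrow> type_of B (F x) = type_of A x"
    and hom: "\<And>x y. \<lbrakk>x \<in> obj A; y \<in> obj A\<rbrakk> \<Longrightarrow>
      arr A x y \<sqsubseteq>\<^bsub>Hom Q (type_of A x) (type_of A y)\<^esub> arr B (F x) (F y)"
  shows "cograph A B F \<in> carrier (Dist Q B A)"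
proof -
  interpret A: qcategory Q A by (rule A)
  interpret B: qcategory Q B by (rule B)
  have arr_F: "arr B b (F y) \<in> carrier (Hom Q (type_of B b) (type_of A y))"
    if "b \<in> obj B" "y \<in> obj A" for b y
    using B.arr_closed[of b "F y"] F that by simp
  have arr_FF: "arr B (F x) (F y) \<in> carrier (Hom Q (type_of A x) (type_of A y))"
    if "x \<in> obj A" "y \<in> obj A" for x y
    using arr_F[of "F x" y] F that by simp
  note closed = arr_F arr_FF A.arr_closed B.arr_closed A.type_of_closed B.type_of_closed comp_closed
  show ?thesis
    unfolding cograph_def
  proof (rule Dist_I, goal_cases)
    case 1
    then show ?case by (auto simp: closed)
  next
    case (2 b y' y)
    have "qcomp Q (type_of B b) (type_of A y') (type_of A y) (arr A y' y) (arr B b (F y'))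
        \<sqsubseteq>\<^bsub>Hom Q (type_of B b) (type_of A y)\<^esub>
        qcomp Q (type_of B b) (type_of A y') (type_of A y) (arr B (F y') (F y)) (arr B b (F y'))"
      using 2 by (intro comp_mono_left hom) (simp_all add: closed)
    also have "\<dots> \<sqsubseteq>\<^bsub>Hom Q (type_of B b) (type_of A y)\<^esub> arr B b (F y)"
      using B.arr_trans[of b "F y'" "F y"] 2 F by simp
    finally show ?case
      using 2 F by (simp add: closed)
  next
    case (3 b b' y)
    then show ?case using B.arr_trans[of b b' "F y"] F by simp
  qed
qed

end

section \<open>Weighted colimits and tensors\<close>

context qcategory
begin

lemma qcategory_self: "qcategory Q A"
  by unfold_locales

lemma yoneda_closed:
  assumes "y \<in> obj A"
  shows "(\<lambda>x\<in>obj A. \<lambda>_. arr A x y) \<in> carrier (Dist Q A (star Q (type_of A y)))"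
  using assms
  by (intro Dist_I)
    (auto simp: PiE_def arr_closed type_of_closed comp_ide_left hom_refl arr_trans)

lemma cograph_yoneda_in_Dist:
  "cograph A (presheaf_cat Q A) (yoneda A) \<in> carrier (Dist Q (presheaf_cat Q A) A)"
proof (rule cograph_in_Dist[OF qcategory_self qcategory_presheaf_cat[OF qcategory_self]])
  fix x y assume "x \<in> obj A" "y \<in> obj A"
  then show "arr A x y \<sqsubseteq>\<^bsub>Hom Q (type_of A x) (type_of A y)\<^esub>
      arr (presheaf_cat Q A) (yoneda A x) (yoneda A y)"
    by (simp add: yoneda_def presheaf_hom_le_iff[OF qcategory_self] type_of_closed yoneda_closed
        arr_closed arr_trans)
qed (simp_all add: yoneda_def type_of_closed yoneda_closed)

lemma cograph_yoneda_le_iff: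
  assumes "X \<in> Ob Q" "\<mu> \<in> carrier (Dist Q A (star Q X))" "y \<in> obj A"
    and "g \<in> carrier (Hom Q X (type_of A y))"
  shows "g \<sqsubseteq>\<^bsub>Hom Q X (type_of A y)\<^esub> cograph A (presheaf_cat Q A) (yoneda A) (X, \<mu>) y \<longleftrightarrow>
    (\<forall>x\<in>obj A. qcomp Q (type_of A x) X (type_of A y) g (\<mu> x ())
      \<sqsubseteq>\<^bsub>Hom Q (type_of A x) (type_of A y)\<^esub> arr A x y)"
  using assms
  by (simp add: cograph_def yoneda_def presheaf_hom_le_iff[OF qcategory_self] type_of_closed
      yoneda_closed)

lemma hom_cograph_in_Dist:
  assumes a: "a \<in> obj A"
  shows "hom_cograph Q A a \<in> carrier (Dist Q (presheaf_cat Q (star Q (type_of A a))) A)"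
  unfolding hom_cograph_def
proof (rule cograph_in_Dist[OF qcategory_self])
  have star: "qcategory Q (star Q (type_of A a))"
    using a by (simp add: qcategory_star type_of_closed)
  then show "qcategory Q (presheaf_cat Q (star Q (type_of A a)))"
    by (rule qcategory_presheaf_cat)
  fix x y assume "x \<in> obj A" "y \<in> obj A"
  then show "arr A x y \<sqsubseteq>\<^bsub>Hom Q (type_of A x) (type_of A y)\<^esub>
      arr (presheaf_cat Q (star Q (type_of A a))) (hom_functor A a x) (hom_functor A a y)"
    using a
    by (simp add: hom_functor_def presheaf_hom_le_iff[OF star] type_of_closed Dist_star_star_iff
        arr_closed arr_trans)
qed (use a in \<open>simp_all add: hom_functor_def type_of_closed Dist_star_star_iff arr_closed\<close>)

lemma hom_cograph_le_iff:
  assumes "a \<in> obj A" "X \<in> Ob Q" "f \<in> carrier (Dist Q (star Q (type_of A a)) (star Q X))"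
    and "y \<in> obj A" "g \<in> carrier (Hom Q X (type_of A y))"
  shows "g \<sqsubseteq>\<^bsub>Hom Q X (type_of A y)\<^esub> hom_cograph Q A a (X, f) y \<longleftrightarrow>
    qcomp Q (type_of A a) X (type_of A y) g (f () ())
      \<sqsubseteq>\<^bsub>Hom Q (type_of A a) (type_of A y)\<^esub> arr A a y"
  using assms
  by (simp add: hom_cograph_def cograph_def hom_functor_def type_of_closed Dist_star_star_iff
      presheaf_hom_le_iff[OF qcategory_star] arr_closed)

lemma cograph_yoneda_row:
  assumes "X \<in> Ob Q" "\<mu> \<in> carrier (Dist Q A (star Q X))"
  shows "(\<lambda>_. cograph A (presheaf_cat Q A) (yoneda A) (X, \<mu>)) \<in> carrier (Dist Q (star Q X) A)"
  using row_in_Dist[OF qcategory_self qcategory_presheaf_cat[OF qcategory_self]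
      cograph_yoneda_in_Dist, of "(X, \<mu>)"] assms by simp

lemma hom_cograph_row:
  assumes "a \<in> obj A" "X \<in> Ob Q" "f \<in> carrier (Dist Q (star Q (type_of A a)) (star Q X))"
  shows "(\<lambda>_. hom_cograph Q A a (X, f)) \<in> carrier (Dist Q (star Q X) A)"
  using row_in_Dist[OF qcategory_self qcategory_presheaf_cat[OF qcategory_star]
      hom_cograph_in_Dist, of a "(X, f)"] assms by (simp add: type_of_closed)

lemma M_cocomplete_iff:
  "M_cocomplete Q A \<longleftrightarrow>
    (\<forall>X\<in>Ob Q. \<forall>\<mu>\<in>carrier (Dist Q A (star Q X)).
      left_adjoint_dist Q (star Q X) A (\<lambda>_. cograph A (presheaf_cat Q A) (yoneda A) (X, \<mu>)))"
  unfolding M_cocomplete_def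
    left_adjoint_dist_iff_rows[OF qcategory_self qcategory_presheaf_cat[OF qcategory_self]
      cograph_yoneda_in_Dist]
  by (simp add: ball_presheaf_iff)

lemma M_tensored_iff:
  "M_tensored Q A \<longleftrightarrow>
    (\<forall>a\<in>obj A. \<forall>X\<in>Ob Q. \<forall>f\<in>carrier (Dist Q (star Q (type_of A a)) (star Q X)).
      left_adjoint_dist Q (star Q X) A (\<lambda>_. hom_cograph Q A a (X, f)))"
  unfolding M_tensored_def
  by (simp add: ball_presheaf_iff type_of_closed left_adjoint_dist_iff_rows[OF qcategory_self
        qcategory_presheaf_cat[OF qcategory_star] hom_cograph_in_Dist])

text \<open>
  The criterion identifies the meet of \<open>A(x\<^sub>i,-) \<swarrow> f\<^sub>i\<close> with \<open>A \<swarrow> \<mu>\<close> by comparing lower bounds, so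
  it serves both for a given \<open>\<mu>\<close> and for a \<open>\<mu>\<close> built from a given family.
\<close>

lemma Inf_hom_cograph_eqI:
  assumes X: "X \<in> Ob Q" and \<mu>: "\<mu> \<in> carrier (Dist Q A (star Q X))"
    and x: "\<And>i. i \<in> I \<Longrightarrow> x i \<in> obj A"
    and f: "\<And>i. i \<in> I \<Longrightarrow> f i \<in> carrier (Dist Q (star Q (type_of A (x i))) (star Q X))"
    and below: "\<And>y g. \<lbrakk>y \<in> obj A; g \<in> carrier (Hom Q X (type_of A y))\<rbrakk> \<Longrightarrow>
      (\<forall>z\<in>obj A. qcomp Q (type_of A z) X (type_of A y) g (\<mu> z ())
        \<sqsubseteq>\<^bsub>Hom Q (type_of A z) (type_of A y)\<^esub> arr A z y) \<longleftrightarrow>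
      (\<forall>i\<in>I. qcomp Q (type_of A (x i)) X (type_of A y) g (f i () ())
        \<sqsubseteq>\<^bsub>Hom Q (type_of A (x i)) (type_of A y)\<^esub> arr A (x i) y)"
  shows "\<Sqinter>\<^bsub>Dist Q (star Q X) A\<^esub> ((\<lambda>i _. hom_cograph Q A (x i) (X, f i)) ` I)
    = (\<lambda>_. cograph A (presheaf_cat Q A) (yoneda A) (X, \<mu>))"
proof (rule Dist_Inf_eqI[OF qcategory_self qcategory_star[OF X] cograph_yoneda_row[OF X \<mu>]])
  fix u y g
  assume y: "y \<in> obj A" and "g \<in> carrier (Hom Q (type_of (star Q X) u) (type_of A y))"
  then have g: "g \<in> carrier (Hom Q X (type_of A y))" by simp
  then show "g \<sqsubseteq>\<^bsub>Hom Q (type_of (star Q X) u) (type_of A y)\<^esub>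
      cograph A (presheaf_cat Q A) (yoneda A) (X, \<mu>) y \<longleftrightarrow>
      (\<forall>i\<in>I. g \<sqsubseteq>\<^bsub>Hom Q (type_of (star Q X) u) (type_of A y)\<^esub> hom_cograph Q A (x i) (X, f i) y)"
    using cograph_yoneda_le_iff[OF X \<mu> y g] hom_cograph_le_iff[OF x X f y g] below[OF y g] by auto
qed (simp add: hom_cograph_row x f X)

lemma cograph_yoneda_eq_Inf:
  assumes X: "X \<in> Ob Q" and \<mu>: "\<mu> \<in> carrier (Dist Q A (star Q X))"
  shows "(\<lambda>_. cograph A (presheaf_cat Q A) (yoneda A) (X, \<mu>))
    = \<Sqinter>\<^bsub>Dist Q (star Q X) A\<^esub> ((\<lambda>x _. hom_cograph Q A x (X, \<lambda>_ _. \<mu> x ())) ` obj A)"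
  using Dist_closed[OF \<mu>]
  by (intro Inf_hom_cograph_eqI[OF X \<mu>, symmetric]) (auto simp: Dist_star_star_iff X type_of_closed)

text \<open>
  The presheaf is \<open>\<mu> = \<Squnion>\<^sub>i f\<^sub>i \<circ> A(-,x\<^sub>i)\<close>. If \<open>g \<circ> \<mu>(z) \<le> A(z,y)\<close> for all \<open>z\<close>, then taking
  \<open>z = x\<^sub>i\<close> and the identity below \<open>A(x\<^sub>i,x\<^sub>i)\<close> gives \<open>g \<circ> f\<^sub>i \<le> A(x\<^sub>i,y)\<close>; conversely
  \<open>g \<circ> f\<^sub>i \<circ> A(z,x\<^sub>i) \<le> A(x\<^sub>i,y) \<circ> A(z,x\<^sub>i) \<le> A(z,y)\<close>. This is the Yoneda lemma for joins of
  weighted representables.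
\<close>

lemma M_cocomplete_imp_left_adjoint_Inf:
  assumes cocomplete: "M_cocomplete Q A" and X: "X \<in> Ob Q"
    and x: "\<And>i. i \<in> I \<Longrightarrow> x i \<in> obj A"
    and f: "\<And>i. i \<in> I \<Longrightarrow> f i \<in> carrier (Dist Q (star Q (type_of A (x i))) (star Q X))"
  shows "left_adjoint_dist Q (star Q X) A
    (\<Sqinter>\<^bsub>Dist Q (star Q X) A\<^esub> ((\<lambda>i _. hom_cograph Q A (x i) (X, f i)) ` I))"
proof -
  have f_closed: "f i () () \<in> carrier (Hom Q (type_of A (x i)) X)" if "i \<in> I" for i
    using f[OF that] x[OF that] X by (simp add: Dist_star_star_iff type_of_closed)
  note closed = f_closed x arr_closed type_of_closed X comp_closed
  define summand where "summand z i = qcomp Q (type_of A z) (type_of A (x i)) X (f i () ()) (arr A z (x i))"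
    for z i
  have summand: "summand z ` I \<subseteq> carrier (Hom Q (type_of A z) X)" if "z \<in> obj A" for z
    using that by (auto simp: summand_def closed)
  define \<mu> where "\<mu> = (\<lambda>z\<in>obj A. \<lambda>_::unit. \<Squnion>\<^bsub>Hom Q (type_of A z) X\<^esub> (summand z ` I))"
  have \<mu>_closed: "\<mu> z () \<in> carrier (Hom Q (type_of A z) X)" if "z \<in> obj A" for z
    using that summand by (simp add: \<mu>_def Sup_closed closed)
  have summand_le: "summand z i \<sqsubseteq>\<^bsub>Hom Q (type_of A z) X\<^esub> \<mu> z ()" if "z \<in> obj A" "i \<in> I" for z i
    using that summand by (auto simp: \<mu>_def closed intro!: Sup_upper)
  have \<mu>: "\<mu> \<in> carrier (Dist Q A (star Q X))"
  proof (rule Dist_I, goal_cases)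
    case 1
    then show ?case using \<mu>_closed by (auto simp: PiE_def \<mu>_def)
  next
    case (2 z u v)
    then show ?case using \<mu>_closed by (simp add: comp_ide_left hom_refl closed)
  next
    case (3 z z' u)
    have "qcomp Q (type_of A z) (type_of A z') X (summand z' i) (arr A z z')
        \<sqsubseteq>\<^bsub>Hom Q (type_of A z) X\<^esub> \<mu> z ()" if i: "i \<in> I" for i
    proof -
      have "qcomp Q (type_of A z) (type_of A z') X (summand z' i) (arr A z z')
          = qcomp Q (type_of A z) (type_of A (x i)) X (f i () ())
            (qcomp Q (type_of A z) (type_of A z') (type_of A (x i)) (arr A z' (x i)) (arr A z z'))"
        using 3 i by (simp add: summand_def comp_assoc closed)
      also have "\<dots> \<sqsubseteq>\<^bsub>Hom Q (type_of A z) X\<^esub> summand z i"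
        unfolding summand_def using 3 i by (intro comp_mono_right arr_trans) (simp_all add: closed)
      also have "summand z i \<sqsubseteq>\<^bsub>Hom Q (type_of A z) X\<^esub> \<mu> z ()"
        using 3 i by (intro summand_le) simp_all
      finally show ?thesis
        using 3 i \<mu>_closed[of z] by (simp add: summand_def closed)
    qed
    then have "qcomp Q (type_of A z) (type_of A z') X (\<Squnion>\<^bsub>Hom Q (type_of A z') X\<^esub> (summand z' ` I))
        (arr A z z') \<sqsubseteq>\<^bsub>Hom Q (type_of A z) X\<^esub> \<mu> z ()"
      using 3 summand[of z'] \<mu>_closed[of z] by (subst comp_Sup_left_le_iff) (auto simp: closed)
    then show ?case using 3 by (simp add: \<mu>_def)
  qed
  have below: "(\<forall>z\<in>obj A. qcomp Q (type_of A z) X (type_of A y) g (\<mu> z ())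
        \<sqsubseteq>\<^bsub>Hom Q (type_of A z) (type_of A y)\<^esub> arr A z y) \<longleftrightarrow>
      (\<forall>i\<in>I. qcomp Q (type_of A (x i)) X (type_of A y) g (f i () ())
        \<sqsubseteq>\<^bsub>Hom Q (type_of A (x i)) (type_of A y)\<^esub> arr A (x i) y)"
    if y: "y \<in> obj A" and g: "g \<in> carrier (Hom Q X (type_of A y))" for y g
  proof
    assume bound: "\<forall>z\<in>obj A. qcomp Q (type_of A z) X (type_of A y) g (\<mu> z ())
        \<sqsubseteq>\<^bsub>Hom Q (type_of A z) (type_of A y)\<^esub> arr A z y"
    show "\<forall>i\<in>I. qcomp Q (type_of A (x i)) X (type_of A y) g (f i () ())
        \<sqsubseteq>\<^bsub>Hom Q (type_of A (x i)) (type_of A y)\<^esub> arr A (x i) y"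
    proof
      fix i assume i: "i \<in> I"
      let ?X = "type_of A (x i)"
      have "qcomp Q ?X ?X X (f i () ()) (ide Q ?X) \<sqsubseteq>\<^bsub>Hom Q ?X X\<^esub> summand (x i) i"
        unfolding summand_def using i
        by (intro comp_mono_right arr_refl) (simp_all add: closed ide_closed)
      also have "summand (x i) i \<sqsubseteq>\<^bsub>Hom Q ?X X\<^esub> \<mu> (x i) ()"
        using i x by (intro summand_le) simp_all
      finally have "f i () () \<sqsubseteq>\<^bsub>Hom Q ?X X\<^esub> \<mu> (x i) ()"
        using i \<mu>_closed[of "x i"] by (simp add: summand_def closed ide_closed comp_ide_right)
      then have "qcomp Q ?X X (type_of A y) g (f i () ())
          \<sqsubseteq>\<^bsub>Hom Q ?X (type_of A y)\<^esub> qcomp Q ?X X (type_of A y) g (\<mu> (x i) ())"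
        using i y g \<mu>_closed by (intro comp_mono_right) (simp_all add: closed)
      also have "\<dots> \<sqsubseteq>\<^bsub>Hom Q ?X (type_of A y)\<^esub> arr A (x i) y"
        using bound i x by blast
      finally show "qcomp Q ?X X (type_of A y) g (f i () ())
          \<sqsubseteq>\<^bsub>Hom Q ?X (type_of A y)\<^esub> arr A (x i) y"
        using i y g \<mu>_closed by (simp add: closed)
    qed
  next
    assume bound: "\<forall>i\<in>I. qcomp Q (type_of A (x i)) X (type_of A y) g (f i () ())
        \<sqsubseteq>\<^bsub>Hom Q (type_of A (x i)) (type_of A y)\<^esub> arr A (x i) y"
    show "\<forall>z\<in>obj A. qcomp Q (type_of A z) X (type_of A y) g (\<mu> z ())
        \<sqsubseteq>\<^bsub>Hom Q (type_of A z) (type_of A y)\<^esub> arr A z y"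
    proof
      fix z assume z: "z \<in> obj A"
      let ?Z = "type_of A z" and ?Y = "type_of A y"
      have "qcomp Q ?Z X ?Y g (summand z i) \<sqsubseteq>\<^bsub>Hom Q ?Z ?Y\<^esub> arr A z y" if i: "i \<in> I" for i
      proof -
        let ?X = "type_of A (x i)"
        have "qcomp Q ?Z X ?Y g (summand z i)
            = qcomp Q ?Z ?X ?Y (qcomp Q ?X X ?Y g (f i () ())) (arr A z (x i))"
          using i y z g by (simp add: summand_def comp_assoc closed)
        also have "\<dots> \<sqsubseteq>\<^bsub>Hom Q ?Z ?Y\<^esub> qcomp Q ?Z ?X ?Y (arr A (x i) y) (arr A z (x i))"
          using i y z g bound by (intro comp_mono_left) (simp_all add: closed)
        also have "\<dots> \<sqsubseteq>\<^bsub>Hom Q ?Z ?Y\<^esub> arr A z y"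
          using i y z x by (intro arr_trans) simp_all
        finally show ?thesis
          using i y z g by (simp add: summand_def closed)
      qed
      then have "qcomp Q ?Z X ?Y g (\<Squnion>\<^bsub>Hom Q ?Z X\<^esub> (summand z ` I)) \<sqsubseteq>\<^bsub>Hom Q ?Z ?Y\<^esub> arr A z y"
        using y z g summand[of z] by (subst comp_Sup_right_le_iff) (auto simp: closed)
      then show "qcomp Q ?Z X ?Y g (\<mu> z ()) \<sqsubseteq>\<^bsub>Hom Q ?Z ?Y\<^esub> arr A z y"
        using z by (simp add: \<mu>_def)
    qed
  qed
  have "\<Sqinter>\<^bsub>Dist Q (star Q X) A\<^esub> ((\<lambda>i _. hom_cograph Q A (x i) (X, f i)) ` I)
      = (\<lambda>_. cograph A (presheaf_cat Q A) (yoneda A) (X, \<mu>))"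
    by (intro Inf_hom_cograph_eqI X \<mu> x f below)
  then show ?thesis
    using cocomplete X \<mu> by (simp add: M_cocomplete_iff)
qed

lemma M_cocomplete_imp_M_tensored:
  assumes "M_cocomplete Q A"
  shows "M_tensored Q A"
  unfolding M_tensored_iff
proof (intro ballI)
  fix a X f
  assume a: "a \<in> obj A" and X: "X \<in> Ob Q"
    and f: "f \<in> carrier (Dist Q (star Q (type_of A a)) (star Q X))"
  have "left_adjoint_dist Q (star Q X) A
      (\<Sqinter>\<^bsub>Dist Q (star Q X) A\<^esub> ((\<lambda>_ _. hom_cograph Q A a (X, f)) ` {()}))"
    using a X f by (intro M_cocomplete_imp_left_adjoint_Inf[OF assms X]) auto
  moreover have "\<Sqinter>\<^bsub>Dist Q (star Q X) A\<^esub> ((\<lambda>_ _. hom_cograph Q A a (X, f)) ` {()})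
      = (\<lambda>_. hom_cograph Q A a (X, f))"
    using a X f
    by (intro Dist_Inf_eqI[OF qcategory_self qcategory_star]) (auto simp: hom_cograph_row)
  ultimately show "left_adjoint_dist Q (star Q X) A (\<lambda>_. hom_cograph Q A a (X, f))" by simp
qed

lemma M_tensored_conically_imp_M_cocomplete:
  assumes "M_tensored Q A" "M_conically_cocomplete Q A"
  shows "M_cocomplete Q A"
  unfolding M_cocomplete_iff
proof (intro ballI)
  fix X \<mu> assume X: "X \<in> Ob Q" and \<mu>: "\<mu> \<in> carrier (Dist Q A (star Q X))"
  have component: "(\<lambda>_ _. \<mu> x ()) \<in> carrier (Dist Q (star Q (type_of A x)) (star Q X))"
    if "x \<in> obj A" for x
    using Dist_closed[OF \<mu> that, of "()"] that X by (simp add: Dist_star_star_iff type_of_closed)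
  show "left_adjoint_dist Q (star Q X) A (\<lambda>_. cograph A (presheaf_cat Q A) (yoneda A) (X, \<mu>))"
    unfolding cograph_yoneda_eq_Inf[OF X \<mu>]
    using assms(1) component X
    by (intro M_conically_cocompleteD[OF assms(2) X]) (auto simp: M_tensored_iff)
qed

end

theorem theorem4p12:
  fixes Q :: "('o, 'm) quantaloid_data"
    and A :: "('o, 'm, 'a) qcat"
  assumes "quantaloid Q"
    and "qcategory Q A"
  shows "M_cocomplete Q A \<longleftrightarrow> M_tensored Q A \<and> M_conically_cocomplete Q A"
proof -
  interpret qcategory Q A by fact
  show ?thesis
  proof
    assume cocomplete: "M_cocomplete Q A"
    then have "M_conically_cocomplete Q A"
      unfolding M_conically_cocomplete_def by (intro ballI allI impI M_cocomplete_imp_left_adjoint_Inf) auto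
    with cocomplete show "M_tensored Q A \<and> M_conically_cocomplete Q A"
      using M_cocomplete_imp_M_tensored by blast
  qed (use M_tensored_conically_imp_M_cocomplete in blast)
qed

end
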